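(* Let $L\ge 1$ be an integer and assume that $\frac{\partial^{2L}u}{\partial x^{2L}}$ exists and is bounded on $[0,T]\times\mathbb{R}$, where $u$ is the function representing the solution of the backward stochastic differential equation by $y_t=u(t,W_t)$. Then there is a constant $C$, independent of $n$, $j$, $h$ and $x$, such that for all integers $n\ge 0$, $j\ge 1$ with $n+j\le N$ and all $x\in\mathbb{R}$, $$\left|E_{t_n}^{x}[y_{t_{n+j}}]-\hat E_{t_n}^{x}[y_{t_{n+j}}]\right|\le C\,(jh)^{L},$$ where $$\hat E_{t_n}^{x}[y_{t_{n+j}}]=\frac{1}{\sqrt{\pi}}\sum_{i=1}^{L}\omega_i\,u\big(t_{n+j},\,x+\sqrt{2jh}\,a_i\big)$$ is the $L$-point Gauss-Hermite approximation of the conditional expectation.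
   Context: Let $W$ be a standard one-dimensional Brownian motion on a complete filtered probability space, $T>0$, and let $(y_t,z_t)$ be the unique adapted square-integrable solution of the scalar backward stochastic differential equation $y_t=\varphi(W_T)+\int_t^T f(s,y_s,z_s)\,ds-\int_t^T z_s\,dW_s$, $t\in[0,T]$ (case $m=d=1$). The functions $f$ and $\varphi$ are assumed smooth enough, with themselves and their derivatives all bounded. The solution is represented as $y_t=u(t,W_t)$, $z_t=\partial_x u(t,W_t)$, where $u$ solves $\partial_t u+\frac12\partial_x^2u+f(t,u,\partial_x u)=0$ with $u(T,x)=\varphi(x)$. Time grid: $t_n=nh$, $n=0,\dots,N$, with $h=T/N$. $E_{t_n}^{x}[\cdot]$ denotes the conditional expectation given that the Brownian path starts from the time-space point $(t_n,x)$, so that $$E_{t_n}^{x}[y_{t_{n+j}}]=E\big[u(t_{n+j},x+W_{t_{n+j}}-W_{t_n})\big]=\frac{1}{\sqrt{2\pi jh}}\int_{\mathbb{R}}u(t_{n+j},x+v)e^{-v^2/(2jh)}\,dv.$$ Gauss-Hermite nodes and weights: $a_1,\dots,a_L$ are the roots of the Hermite polynomial $H_L(x)=(-1)^Le^{x^2}\frac{d^L}{dx^L}(e^{-x^2})$, and $\omega_i=\frac{2^{L+1}L!\sqrt{\pi}}{(H_L'(a_i))^2}$; these are the nodes and weights of the quadrature rule $\int_{\mathbb{R}}g(x)e^{-x^2}dx\approx\sum_{i=1}^L\omega_i g(a_i)$. *)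

theory Defs
  imports "HOL-Probability.Probability"
begin

section \<open>Gauss-Hermite quadrature\<close>

definition hermite :: "nat \<Rightarrow> real \<Rightarrow> real" where
  "hermite L x = (- 1) ^ L * exp (x\<^sup>2) * (deriv ^^ L) (\<lambda>v. exp (- (v\<^sup>2))) x"

text \<open>The roots of the \<open>L\<close>-th Hermite polynomial are numbered \<open>1, \<dots>, L\<close> in increasing order.\<close>

definition gh_node :: "nat \<Rightarrow> nat \<Rightarrow> real" where
  "gh_node L i = sorted_list_of_set {x. hermite L x = 0} ! (i - 1)"

definition gh_weight :: "nat \<Rightarrow> nat \<Rightarrow> real" where
  "gh_weight L i = 2 ^ (L + 1) * fact L * sqrt pi / (deriv (hermite L) (gh_node L i))\<^sup>2"

definition gh_expectation :: "nat \<Rightarrow> (real \<Rightarrow> real \<Rightarrow> real) \<Rightarrow> real \<Rightarrow> real \<Rightarrow> real \<Rightarrow> real" where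
  "gh_expectation L u \<delta> t x =
     1 / sqrt pi * (\<Sum>i = 1..L. gh_weight L i * u t (x + sqrt (2 * \<delta>) * gh_node L i))"


section \<open>Functions with bounded derivatives\<close>

text \<open>
  \<open>Cb k S g\<close>: on \<open>S\<close>, the function \<open>g\<close> has continuous partial derivatives up to order \<open>k\<close>,
  and \<open>g\<close> and all these derivatives are bounded. It is used for convex \<open>S\<close> with nonempty
  interior, where the derivative within \<open>S\<close> is unique.
\<close>

primrec Cb :: "nat \<Rightarrow> 'a::euclidean_space set \<Rightarrow> ('a \<Rightarrow> real) \<Rightarrow> bool" where
  "Cb 0 S g \<longleftrightarrow> continuous_on S g \<and> bounded (g ` S)"
| "Cb (Suc k) S g \<longleftrightarrow> bounded (g ` S) \<and>
     (\<exists>D. (\<forall>x\<in>S. (g has_derivative D x) (at x within S)) \<and> (\<forall>b\<in>Basis. Cb k S (\<lambda>x. D x b)))"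


section \<open>Brownian motion on a filtered probability space\<close>

text \<open>
  The library locale of filtrations indexes by all reals. Only indices in \<open>[0, T]\<close> are used below,
  and a filtration on \<open>[0, T]\<close> extends to the real line by clamping the index.
\<close>

locale complete_filtered_prob_space =
  prob_space M + complete_measure M + filtration "space M" F
  for M :: "'a measure" and F :: "real \<Rightarrow> 'a measure" and T :: real +
  assumes filtration_sub: "\<And>t. t \<in> {0..T} \<Longrightarrow> sets (F t) \<subseteq> sets M"
    and filtration_complete: "null_sets M \<subseteq> sets (F 0)"

locale brownian_motion = complete_filtered_prob_space M F T
  for M :: "'a measure" and F :: "real \<Rightarrow> 'a measure" and T :: real +
  fixes W :: "real \<Rightarrow> 'a \<Rightarrow> real"
  assumes W_adapted: "\<And>t. t \<in> {0..T} \<Longrightarrow> W t \<in> borel_measurable (F t)"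
    and W_zero: "AE \<omega> in M. W 0 \<omega> = 0"
    and W_continuous: "AE \<omega> in M. continuous_on {0..T} (\<lambda>t. W t \<omega>)"
    and W_increment: "\<And>s t. 0 \<le> s \<Longrightarrow> s < t \<Longrightarrow> t \<le> T \<Longrightarrow>
      distributed M lborel (\<lambda>\<omega>. W t \<omega> - W s \<omega>) (normal_density 0 (sqrt (t - s)))"
    and W_indep: "\<And>s t. 0 \<le> s \<Longrightarrow> s < t \<Longrightarrow> t \<le> T \<Longrightarrow>
      indep_set (sets (F s)) {(\<lambda>\<omega>. W t \<omega> - W s \<omega>) -` B \<inter> space M | B. B \<in> sets borel}"

text \<open>
  For the path \<open>x + W r - W s\<close>, \<open>r \<ge> s\<close>, started from the time-space point \<open>(s, x)\<close>, this is the
  expected value at time \<open>t\<close> of the process represented by \<open>u\<close>.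
\<close>

definition start_expectation ::
  "'a measure \<Rightarrow> (real \<Rightarrow> 'a \<Rightarrow> real) \<Rightarrow> (real \<Rightarrow> real \<Rightarrow> real) \<Rightarrow> real \<Rightarrow> real \<Rightarrow> real \<Rightarrow> real" where
  "start_expectation M W u s t x = (\<integral>\<omega>. u t (x + W t \<omega> - W s \<omega>) \<partial>M)"


section \<open>The Ito integral\<close>

text \<open>
  A simple process on \<open>]a, b]\<close> is given by the number \<open>m\<close> of its steps, the partition \<open>p\<close> and
  the values \<open>\<xi>\<close>: it takes the value \<open>\<xi> i\<close> on \<open>]p i, p (i + 1)]\<close>.
\<close>

definition simple_process ::
  "'a measure \<Rightarrow> (real \<Rightarrow> 'a measure) \<Rightarrow> real \<Rightarrow> real \<Rightarrow> nat \<Rightarrow> (nat \<Rightarrow> real) \<Rightarrow> (nat \<Rightarrow> 'a \<Rightarrow> real) \<Rightarrow> bool"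
  where
  "simple_process M F a b m p \<xi> \<longleftrightarrow> p 0 = a \<and> p m = b \<and> (\<forall>i<m. p i \<le> p (Suc i)) \<and>
     (\<forall>i<m. \<xi> i \<in> borel_measurable (F (p i)) \<and> bounded (\<xi> i ` space M))"

definition simple_value ::
  "nat \<Rightarrow> (nat \<Rightarrow> real) \<Rightarrow> (nat \<Rightarrow> 'a \<Rightarrow> real) \<Rightarrow> real \<Rightarrow> 'a \<Rightarrow> real" where
  "simple_value m p \<xi> s \<omega> = (\<Sum>i<m. \<xi> i \<omega> * indicator {p i<..p (Suc i)} s)"

definition simple_integral ::
  "(real \<Rightarrow> 'a \<Rightarrow> real) \<Rightarrow> nat \<Rightarrow> (nat \<Rightarrow> real) \<Rightarrow> (nat \<Rightarrow> 'a \<Rightarrow> real) \<Rightarrow> 'a \<Rightarrow> real" where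
  "simple_integral W m p \<xi> \<omega> = (\<Sum>i<m. \<xi> i \<omega> * (W (p (Suc i)) \<omega> - W (p i) \<omega>))"

definition has_ito_integral ::
  "'a measure \<Rightarrow> (real \<Rightarrow> 'a measure) \<Rightarrow> (real \<Rightarrow> 'a \<Rightarrow> real) \<Rightarrow> (real \<Rightarrow> 'a \<Rightarrow> real) \<Rightarrow>
    real \<Rightarrow> real \<Rightarrow> ('a \<Rightarrow> real) \<Rightarrow> bool" where
  "has_ito_integral M F W z a b I \<longleftrightarrow> I \<in> borel_measurable M \<and>
     (\<exists>m p \<xi>. (\<forall>k. simple_process M F a b (m k) (p k) (\<xi> k)) \<and>
       (\<lambda>k. \<integral>\<^sup>+\<omega>. (\<integral>\<^sup>+s\<in>{a..b}. ennreal ((simple_value (m k) (p k) (\<xi> k) s \<omega> - z s \<omega>)\<^sup>2) \<partial>lborel) \<partial>M)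
         \<longlonglongrightarrow> 0 \<and>
       (\<lambda>k. \<integral>\<^sup>+\<omega>. ennreal ((simple_integral W (m k) (p k) (\<xi> k) \<omega> - I \<omega>)\<^sup>2) \<partial>M) \<longlonglongrightarrow> 0)"


section \<open>The backward stochastic differential equation\<close>

definition adapted_square_integrable ::
  "'a measure \<Rightarrow> (real \<Rightarrow> 'a measure) \<Rightarrow> real \<Rightarrow> (real \<Rightarrow> 'a \<Rightarrow> real) \<Rightarrow> bool" where
  "adapted_square_integrable M F T X \<longleftrightarrow>
     (\<forall>t\<in>{0..T}. X t \<in> borel_measurable (F t)) \<and>
     (\<lambda>(t, \<omega>). X t \<omega>) \<in> borel_measurable (restrict_space borel {0..T} \<Otimes>\<^sub>M M) \<and>
     (\<integral>\<^sup>+\<omega>. (\<integral>\<^sup>+t\<in>{0..T}. ennreal ((X t \<omega>)\<^sup>2) \<partial>lborel) \<partial>M) < \<infinity>"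

definition bsde_solution ::
  "'a measure \<Rightarrow> (real \<Rightarrow> 'a measure) \<Rightarrow> real \<Rightarrow> (real \<Rightarrow> 'a \<Rightarrow> real) \<Rightarrow>
    (real \<Rightarrow> real \<Rightarrow> real \<Rightarrow> real) \<Rightarrow> (real \<Rightarrow> real) \<Rightarrow>
    (real \<Rightarrow> 'a \<Rightarrow> real) \<Rightarrow> (real \<Rightarrow> 'a \<Rightarrow> real) \<Rightarrow> bool" where
  "bsde_solution M F T W f \<phi> y z \<longleftrightarrow>
     adapted_square_integrable M F T y \<and> adapted_square_integrable M F T z \<and>
     (\<forall>t\<in>{0..T}. \<exists>I. has_ito_integral M F W z t T I \<and>
       (AE \<omega> in M. y t \<omega> = \<phi> (W T \<omega>) + (LBINT s:{t..T}. f s (y s \<omega>) (z s \<omega>)) - I \<omega>))"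

text \<open>
  Classical solution of the terminal value problem
  \<open>\<partial>\<^sub>t u + 1/2 \<partial>\<^sub>x\<^sup>2 u + f (t, u, \<partial>\<^sub>x u) = 0\<close>, \<open>u (T, x) = \<phi> x\<close>; at \<open>t = 0\<close> the time derivative is
  one-sided.
\<close>

definition pde_solution ::
  "real \<Rightarrow> (real \<Rightarrow> real \<Rightarrow> real \<Rightarrow> real) \<Rightarrow> (real \<Rightarrow> real) \<Rightarrow> (real \<Rightarrow> real \<Rightarrow> real) \<Rightarrow> bool" where
  "pde_solution T f \<phi> u \<longleftrightarrow>
     continuous_on ({0..T} \<times> UNIV) (\<lambda>(t, x). u t x) \<and> (\<forall>x. u T x = \<phi> x) \<and>
     (\<exists>ut ux uxx.
        continuous_on ({0..<T} \<times> UNIV) (\<lambda>(t, x). ut t x) \<and>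
        continuous_on ({0..<T} \<times> UNIV) (\<lambda>(t, x). ux t x) \<and>
        continuous_on ({0..<T} \<times> UNIV) (\<lambda>(t, x). uxx t x) \<and>
        (\<forall>t\<in>{0..<T}. \<forall>x.
          ((\<lambda>s. u s x) has_real_derivative ut t x) (at t within {0..T}) \<and>
          (u t has_real_derivative ux t x) (at x) \<and>
          (ux t has_real_derivative uxx t x) (at x) \<and>
          ut t x + 1 / 2 * uxx t x + f t (u t x) (ux t x) = 0))"

text \<open>The representation \<open>y\<^sub>t = u (t, W\<^sub>t)\<close>, \<open>z\<^sub>t = \<partial>\<^sub>x u (t, W\<^sub>t)\<close>; the process \<open>z\<close> is determined
  only up to equality almost everywhere in time and almost surely.\<close>

definition represents ::
  "'a measure \<Rightarrow> real \<Rightarrow> (real \<Rightarrow> 'a \<Rightarrow> real) \<Rightarrow> (real \<Rightarrow> real \<Rightarrow> real) \<Rightarrow>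
    (real \<Rightarrow> 'a \<Rightarrow> real) \<Rightarrow> (real \<Rightarrow> 'a \<Rightarrow> real) \<Rightarrow> bool" where
  "represents M T W u y z \<longleftrightarrow>
     (\<forall>t\<in>{0..T}. AE \<omega> in M. y t \<omega> = u t (W t \<omega>)) \<and>
     (AE t in lborel. t \<in> {0..T} \<longrightarrow> (AE \<omega> in M. z t \<omega> = deriv (u t) (W t \<omega>)))"

definition bounded_x_derivative :: "real \<Rightarrow> nat \<Rightarrow> (real \<Rightarrow> real \<Rightarrow> real) \<Rightarrow> bool" where
  "bounded_x_derivative T k u \<longleftrightarrow>
     (\<forall>t\<in>{0..T}. \<forall>i<k. \<forall>x. (deriv ^^ i) (u t) field_differentiable at x) \<and>
     (\<exists>B. \<forall>t\<in>{0..T}. \<forall>x. \<bar>(deriv ^^ k) (u t) x\<bar> \<le> B)"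

end

theory Submission
  imports Defs "HOL-Computational_Algebra.Polynomial" "HOL-Real_Asymp.Real_Asymp"
begin

text \<open>
  With \<open>\<delta> = j h\<close>, the increment of the Brownian path over the time \<open>\<delta>\<close> is normal with
  variance \<open>\<delta>\<close>, so after rescaling by \<open>sqrt (2 \<delta>)\<close> the conditional expectation is
  \<open>1 / sqrt pi\<close> times the integral of \<open>g s * exp (- s\<^sup>2)\<close>, where
  \<open>g s = u t (x + sqrt (2 \<delta>) * s)\<close> (\<open>start_expectation_eq\<close>). The quadrature formula
  is \<open>1 / sqrt pi\<close> times the Gauss-Hermite sum of the same \<open>g\<close>. Taylor expansion of \<open>u t\<close> at
  \<open>x\<close> writes \<open>g\<close> as a polynomial of degree less than \<open>2 L\<close> plus a remainder of size at most
  \<open>B (2 \<delta>) ^ L / (2 L)! * s ^ (2 L)\<close>, with \<open>B\<close> the bound of the \<open>2 L\<close>-th derivative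
  (\<open>taylor_poly\<close>). Gauss-Hermite quadrature is exact on the polynomial, so only the remainder
  contributes to the error: through its Gaussian integral and through its values at the \<open>L\<close> nodes,
  and both are at most a constant depending on \<open>L\<close> times that factor (\<open>quadrature_error\<close>). This
  is the power \<open>\<delta> ^ L\<close> of the claim.

  What remains is the exactness below degree \<open>2 L\<close> with the stated nodes and weights
  (\<open>gauss_eq_quadrature\<close> and \<open>hweight_eq\<close>). Integration by parts makes \<open>H\<^sub>L\<close> orthogonal to all
  polynomials of smaller degree (\<open>gauss_hpoly\<close>), and Rolle's theorem shows that \<open>H\<^sub>L\<close> has \<open>L\<close>
  distinct real roots (\<open>hpoly_roots_exist\<close>). Interpolation at the roots then gives some weights
  that are exact below degree \<open>L\<close>; division by \<open>H\<^sub>L\<close> and orthogonality extend the exactness to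
  degree below \<open>2 L\<close>; and testing the formula on \<open>H\<^bsub>L-1\<^esub> * H\<^sub>L / (X - a)\<close>, which vanishes at
  all nodes but \<open>a\<close>, identifies the weight at \<open>a\<close>.
\<close>

section \<open>The Gaussian integral of a polynomial\<close>

definition gauss :: "real poly \<Rightarrow> real" where
  "gauss p = (\<integral>x. poly p x * exp (- (x\<^sup>2)) \<partial>lborel)"

text \<open>The weight \<open>exp (- x\<^sup>2)\<close> is \<open>sqrt pi\<close> times the normal density of variance \<open>1 / 2\<close>, whose
  moments are all finite.\<close>

lemma integrable_power_gauss: "integrable lborel (\<lambda>x::real. x ^ k * exp (- (x\<^sup>2)))"
proof -
  have "integrable lborel (\<lambda>x. sqrt pi * (normal_density 0 (1 / sqrt 2) x * (x - 0) ^ k))"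
    by (intro integrable_mult_right integrable_normal_moment) simp
  moreover have "(\<lambda>x. sqrt pi * (normal_density 0 (1 / sqrt 2) x * (x - 0) ^ k))
      = (\<lambda>x::real. x ^ k * exp (- (x\<^sup>2)))"
    by (simp add: normal_density_def fun_eq_iff power_divide)
  ultimately show ?thesis by (simp only:)
qed

lemma integrable_poly_gauss: "integrable lborel (\<lambda>x::real. poly p x * exp (- (x\<^sup>2)))"
  unfolding poly_altdef sum_distrib_right mult.assoc
  by (intro Bochner_Integration.integrable_sum integrable_mult_right integrable_power_gauss)

lemma gauss_1: "gauss 1 = sqrt pi"
proof -
  have "gauss 1 = (\<integral>x. sqrt pi * normal_density 0 (1 / sqrt 2) x \<partial>lborel)"
    by (simp add: gauss_def normal_density_def power_divide)
  also have "\<dots> = sqrt pi"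
    by simp
  finally show ?thesis .
qed

lemma gauss_add: "gauss (p + q) = gauss p + gauss q"
  unfolding gauss_def
  by (simp add: distrib_right integrable_poly_gauss Bochner_Integration.integral_add)

lemma gauss_smult: "gauss (smult c p) = c * gauss p"
  by (simp add: gauss_def mult.assoc)

lemma gauss_sum: "gauss (\<Sum>i\<in>I. p i) = (\<Sum>i\<in>I. gauss (p i))"
  unfolding gauss_def
  by (simp add: poly_sum sum_distrib_right integrable_poly_gauss Bochner_Integration.integral_sum)

lemma poly_gauss_tendsto_0:
  fixes p :: "real poly"
  shows
  "((\<lambda>x. poly p x * exp (- (x\<^sup>2))) \<longlongrightarrow> 0) at_top"
  "((\<lambda>x. poly p x * exp (- (x\<^sup>2))) \<longlongrightarrow> 0) at_bot"
proof -
  have top: "((\<lambda>x. poly p x * exp (- (x\<^sup>2))) \<longlongrightarrow> 0) at_top" for p :: "real poly"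
  proof -
    have "((\<lambda>x::real. x ^ k * exp (- (x\<^sup>2))) \<longlongrightarrow> 0) at_top" for k
      by real_asymp
    then show ?thesis
      unfolding poly_altdef sum_distrib_right mult.assoc
      by (intro tendsto_null_sum tendsto_mult_right_zero)
  qed
  show "((\<lambda>x. poly p x * exp (- (x\<^sup>2))) \<longlongrightarrow> 0) at_top" by (rule top)
  show "((\<lambda>x. poly p x * exp (- (x\<^sup>2))) \<longlongrightarrow> 0) at_bot"
    using top[of "p \<circ>\<^sub>p [:0, -1:]"]
    by (simp add: filterlim_at_bot_mirror poly_pcompose)
qed

lemma poly_gauss_deriv:
  "((\<lambda>x. poly p x * exp (- (x\<^sup>2))) has_real_derivative
     poly (pderiv p - [:0, 2:] * p) x * exp (- (x\<^sup>2))) (at x)"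
  by (auto intro!: derivative_eq_intros simp: algebra_simps)

text \<open>The derivative of \<open>p x * exp (- x\<^sup>2)\<close> integrates to zero because this function vanishes at
  both ends of the line. Integration by parts against the weight thus becomes an algebraic rule.\<close>

lemma gauss_pderiv: "gauss (pderiv p) = gauss ([:0, 2:] * p)"
proof -
  let ?q = "pderiv p - [:0, 2:] * p"
  have "(LBINT x=-\<infinity>..\<infinity>. poly ?q x * exp (- (x\<^sup>2))) = 0 - 0"
  proof (rule interval_integral_FTC_integrable)
    show "((\<lambda>x. poly p x * exp (- (x\<^sup>2))) has_vector_derivative poly ?q x * exp (- (x\<^sup>2))) (at x)" for x
      using poly_gauss_deriv[of p x] by (simp only: has_real_derivative_iff_has_vector_derivative)
    show "isCont (\<lambda>x. poly ?q x * exp (- (x\<^sup>2))) x" for x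
      by (intro continuous_intros)
    show "set_integrable lborel (einterval (-\<infinity>) \<infinity>) (\<lambda>x. poly ?q x * exp (- (x\<^sup>2)))"
      using integrable_poly_gauss[of ?q] by (simp add: set_integrable_def)
  qed (use poly_gauss_tendsto_0[of p] in \<open>simp_all add: ereal_tendsto_simps\<close>)
  then have "gauss ?q = 0"
    by (simp add: interval_lebesgue_integral_def set_lebesgue_integral_def gauss_def)
  moreover have "gauss (pderiv p) = gauss (?q + [:0, 2:] * p)"
    by simp
  ultimately show ?thesis
    unfolding gauss_add by simp
qed


section \<open>Hermite polynomials\<close>

text \<open>The recursion is the one that differentiation of \<open>hpoly n * exp (- x\<^sup>2)\<close> produces, up to sign.\<close>

primrec hpoly :: "nat \<Rightarrow> real poly" where
  "hpoly 0 = 1"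
| "hpoly (Suc n) = [:0, 2:] * hpoly n - pderiv (hpoly n)"

lemma hpoly_gauss_deriv:
  "((\<lambda>x. poly (hpoly n) x * exp (- (x\<^sup>2))) has_real_derivative
     - (poly (hpoly (Suc n)) x * exp (- (x\<^sup>2)))) (at x)"
  using poly_gauss_deriv[of "hpoly n" x] by (simp add: algebra_simps)

lemma hermite_eq_hpoly: "hermite n = poly (hpoly n)"
proof -
  have "(deriv ^^ n) (\<lambda>v. exp (- (v\<^sup>2))) = (\<lambda>x::real. (- 1) ^ n * (poly (hpoly n) x * exp (- (x\<^sup>2))))"
  proof (induction n)
    case (Suc n)
    have "((\<lambda>x. (- 1) ^ n * (poly (hpoly n) x * exp (- (x\<^sup>2)))) has_real_derivative
        (- 1) ^ Suc n * (poly (hpoly (Suc n)) x * exp (- (x\<^sup>2)))) (at x)" for x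
      using DERIV_cmult[OF hpoly_gauss_deriv[of n x], of "(- 1) ^ n"] by simp
    then show ?case
      unfolding funpow.simps o_apply Suc by (intro ext DERIV_imp_deriv)
  qed simp
  then show ?thesis
    by (simp add: hermite_def fun_eq_iff exp_minus field_simps flip: power_add power_mult_distrib)
qed

lemma degree_hpoly_le: "degree (hpoly n) \<le> n"
proof (induction n)
  case (Suc n)
  have "degree ([:0, 2:] * hpoly n) \<le> Suc n"
    using degree_mult_le[of "[:0, 2:]" "hpoly n"] Suc by simp
  moreover have "degree (pderiv (hpoly n)) \<le> Suc n"
    using Suc by (simp add: degree_pderiv)
  ultimately show ?case
    by (simp only: hpoly.simps degree_diff_le)
qed simp

lemma coeff_hpoly: "coeff (hpoly n) n = 2 ^ n"
proof (induction n)
  case (Suc n)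
  have "coeff (pderiv (hpoly n)) (Suc n) = 0"
    using degree_hpoly_le[of n] by (simp add: coeff_pderiv coeff_eq_0)
  with Suc show ?case by simp
qed simp

lemma degree_hpoly: "degree (hpoly n) = n"
  using degree_hpoly_le[of n] le_degree[of "hpoly n" n] by (simp add: coeff_hpoly)

lemma hpoly_nonzero: "hpoly n \<noteq> 0"
  using coeff_hpoly[of n] by auto

lemma gauss_hpoly_Suc: "gauss (hpoly (Suc n) * q) = gauss (hpoly n * pderiv q)"
proof -
  have "gauss (hpoly (Suc n) * q) + gauss (pderiv (hpoly n * q))
      = gauss ([:0, 2:] * (hpoly n * q)) + gauss (hpoly n * pderiv q)"
    unfolding gauss_add[symmetric] by (rule arg_cong[of _ _ gauss]) (simp add: pderiv_mult algebra_simps)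
  then show ?thesis
    unfolding gauss_pderiv by simp
qed

text \<open>Each integration by parts lowers the index of the Hermite polynomial and differentiates \<open>q\<close>,
  so that in the end the \<open>n\<close>-th derivative of \<open>q\<close>, a constant, is integrated. For \<open>degree q < n\<close> this
  is orthogonality.\<close>

lemma gauss_hpoly:
  assumes "degree q \<le> n"
  shows "gauss (hpoly n * q) = fact n * coeff q n * sqrt pi"
  using assms
proof (induction n arbitrary: q)
  case 0
  then have "q = smult (coeff q 0) 1"
    by (auto elim: degree_eq_zeroE)
  then have "gauss q = coeff q 0 * sqrt pi"
    using gauss_smult gauss_1 by metis
  then show ?case by simp
next
  case (Suc n)
  have "degree (pderiv q) \<le> n"
    using Suc.prems by (simp add: degree_pderiv)
  then show ?case
    by (simp only: gauss_hpoly_Suc Suc.IH coeff_pderiv fact_Suc) (simp add: algebra_simps)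
qed

section \<open>Roots of Hermite polynomials\<close>

text \<open>Rolle's theorem on a half-line, with \<open>\<infinity>\<close> acting as a second zero: unless \<open>F\<close> already
  vanishes at \<open>a + 1\<close>, the decay makes \<open>\<bar>F\<bar>\<close> attain its maximum over a long interval in the interior.\<close>

lemma Rolle_at_top:
  fixes F :: "real \<Rightarrow> real"
  assumes F: "\<And>x. (F has_real_derivative F' x) (at x)"
    and "F a = 0" and lim: "(F \<longlongrightarrow> 0) at_top"
  obtains c where "c > a" "F' c = 0"
proof (cases "F (a + 1) = 0")
  case True
  then show thesis
    using MVT2[of a "a + 1" F F'] F \<open>F a = 0\<close> that by auto
next
  case False
  then have "eventually (\<lambda>x. \<bar>F x\<bar> < \<bar>F (a + 1)\<bar> \<and> x > a + 1) at_top"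
    using lim[unfolded tendsto_iff] by (auto intro!: eventually_conj eventually_gt_at_top)
  then obtain b where b: "\<bar>F b\<bar> < \<bar>F (a + 1)\<bar>" "b > a + 1"
    by (auto dest: eventually_happens)
  have "continuous_on {a..b} (\<lambda>x. \<bar>F x\<bar>)"
    by (intro continuous_intros DERIV_continuous_on[of _ _ F']) (auto intro: has_field_derivative_at_within F)
  then obtain c where c: "c \<in> {a..b}" "\<And>x. x \<in> {a..b} \<Longrightarrow> \<bar>F x\<bar> \<le> \<bar>F c\<bar>"
    using continuous_attains_sup[of "{a..b}" "\<lambda>x. \<bar>F x\<bar>"] b by auto
  have ge: "\<bar>F (a + 1)\<bar> \<le> \<bar>F c\<bar>"
    using c(2)[of "a + 1"] b by simp
  have "c \<noteq> a" "c \<noteq> b"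
    using ge b False \<open>F a = 0\<close> by auto
  with c(1) have ab: "a < c" "c < b" by auto
  define d where "d = min (c - a) (b - c)"
  have "d > 0" using ab by (simp add: d_def)
  have le: "\<bar>F y\<bar> \<le> \<bar>F c\<bar>" if "\<bar>c - y\<bar> < d" for y
    using that by (intro c(2)) (auto simp: d_def)
  have "F' c = 0"
  proof (cases "F c > 0")
    case True
    then show ?thesis
      using DERIV_local_max[OF F \<open>d > 0\<close>, of c] le by force
  next
    case False
    then show ?thesis
      using DERIV_local_min[OF F \<open>d > 0\<close>, of c] le by force
  qed
  with ab show thesis using that by blast
qed

lemma Rolle_at_bot:
  fixes F :: "real \<Rightarrow> real"
  assumes F: "\<And>x. (F has_real_derivative F' x) (at x)"
    and "F a = 0" and lim: "(F \<longlongrightarrow> 0) at_bot"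
  obtains c where "c < a" "F' c = 0"
proof -
  have "((\<lambda>x. F (- x)) has_real_derivative - F' (- x)) (at x)" for x
    using DERIV_mirror[of F "F' (- x)" x] F[of "- x"] by simp
  moreover have "((\<lambda>x. F (- x)) \<longlongrightarrow> 0) at_top"
    using lim by (simp add: filterlim_at_bot_mirror)
  ultimately obtain c where "c > - a" "- F' (- c) = 0"
    using Rolle_at_top[of "\<lambda>x. F (- x)" "\<lambda>x. - F' (- x)" "- a"] \<open>F a = 0\<close> by auto
  then show thesis
    using that[of "- c"] by auto
qed

text \<open>The function \<open>F = hpoly n * exp (- x\<^sup>2)\<close> has \<open>n\<close> zeros and vanishes at both infinities, so
  \<open>F'\<close> has a zero in each of the \<open>n + 1\<close> intervals in between; the zeros of \<open>F'\<close> are those of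
  \<open>hpoly (Suc n)\<close>. Increasing enumerations keep track of the intervals: the interval number
  \<open>i\<close> lies between \<open>r (i - 1)\<close> and \<open>r i\<close>, unbounded below for \<open>i = 0\<close> and above for \<open>i = n\<close>.\<close>

lemma hpoly_roots_exist: "\<exists>r. strict_mono_on {..<n} r \<and> (\<forall>i<n. poly (hpoly n) (r i) = 0)"
proof (induction n)
  case 0
  show ?case by (auto simp: strict_mono_on_def)
next
  case (Suc n)
  then obtain r where r: "strict_mono_on {..<n} r" "\<And>i. i < n \<Longrightarrow> poly (hpoly n) (r i) = 0"
    by blast
  define F where "F = (\<lambda>x. poly (hpoly n) x * exp (- (x\<^sup>2)))"
  define F' where "F' = (\<lambda>x. - (poly (hpoly (Suc n)) x * exp (- (x\<^sup>2))))"
  have F: "(F has_real_derivative F' x) (at x)" for x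
    unfolding F_def F'_def by (rule hpoly_gauss_deriv)
  have F0: "F (r i) = 0" if "i < n" for i
    using r(2)[OF that] by (simp add: F_def)
  have lim: "(F \<longlongrightarrow> 0) at_top" "(F \<longlongrightarrow> 0) at_bot"
    unfolding F_def by (rule poly_gauss_tendsto_0)+
  have ex: "\<exists>c. F' c = 0 \<and> (i > 0 \<longrightarrow> r (i - 1) < c) \<and> (i < n \<longrightarrow> c < r i)" if "i \<le> n" for i
  proof (cases "i = 0"; cases "i = n")
    assume "i = 0" "i = n"
    then show ?thesis by (auto simp: F'_def)
  next
    assume "i = 0" "i \<noteq> n"
    then show ?thesis
      using Rolle_at_bot[OF F F0 lim(2), of 0] that by auto
  next
    assume "i \<noteq> 0" "i = n"
    then show ?thesis
      using Rolle_at_top[OF F F0 lim(1), of "n - 1"] by auto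
  next
    assume *: "i \<noteq> 0" "i \<noteq> n"
    have "r (i - 1) < r i"
      using * that by (intro strict_mono_onD[OF r(1)]) auto
    moreover have "F (r (i - 1)) = F (r i)"
      using F0 * that by simp
    ultimately show ?thesis
      using MVT2[of "r (i - 1)" "r i" F F'] F by auto
  qed
  then obtain s where s: "\<And>i. i \<le> n \<Longrightarrow> F' (s i) = 0" "\<And>i. i \<le> n \<Longrightarrow> 0 < i \<Longrightarrow> r (i - 1) < s i"
    "\<And>i. i < n \<Longrightarrow> s i < r i"
    by (metis less_imp_le)
  have "s i < s j" if "i < j" "j \<le> n" for i j
  proof -
    have "s i < r i" using s that by simp
    also have "r i \<le> r (j - 1)"
      using that by (intro strict_mono_on_leD[OF r(1)]) auto
    also have "\<dots> < s j" using s that by simp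
    finally show ?thesis .
  qed
  then have "strict_mono_on {..<Suc n} s"
    by (auto simp: strict_mono_on_def)
  moreover have "poly (hpoly (Suc n)) (s i) = 0" if "i < Suc n" for i
    using s(1)[of i] that by (simp add: F'_def)
  ultimately show ?case by blast
qed

abbreviation hroots :: "nat \<Rightarrow> real set" where
  "hroots n \<equiv> {x. poly (hpoly n) x = 0}"

lemma finite_hroots: "finite (hroots n)"
  by (rule poly_roots_finite[OF hpoly_nonzero])

lemma card_hroots: "card (hroots n) = n"
proof (rule antisym)
  show "card (hroots n) \<le> n"
    using card_poly_roots_bound[OF hpoly_nonzero, of n] by (simp add: degree_hpoly)
  obtain r where r: "strict_mono_on {..<n} r" "\<And>i. i < n \<Longrightarrow> poly (hpoly n) (r i) = 0"
    using hpoly_roots_exist by blast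
  have "card (r ` {..<n}) = n"
    using card_image[OF strict_mono_on_imp_inj_on[OF r(1)]] by simp
  moreover have "card (r ` {..<n}) \<le> card (hroots n)"
    using r(2) by (intro card_mono finite_hroots) auto
  ultimately show "n \<le> card (hroots n)" by simp
qed

lemma hpoly_eq_prod: "hpoly n = smult (2 ^ n) (\<Prod>a\<in>hroots n. [:- a, 1:])"
proof (rule poly_eqI_degree_lead_coeff[where A = "hroots n" and n = n])
  have deg: "degree (\<Prod>a\<in>hroots n. [:- a, 1:]) = n"
    by (subst degree_prod_sum_eq) (simp_all add: card_hroots)
  have "lead_coeff (\<Prod>a\<in>hroots n. [:- a, 1:]) = 1"
    by (simp add: lead_coeff_prod)
  then show "coeff (hpoly n) n = coeff (smult (2 ^ n) (\<Prod>a\<in>hroots n. [:- a, 1:])) n"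
    by (simp add: coeff_hpoly deg)
  show "degree (smult (2 ^ n) (\<Prod>a\<in>hroots n. [:- a, 1:])) \<le> n"
    by (simp add: deg)
  show "poly (hpoly n) z = poly (smult (2 ^ n) (\<Prod>a\<in>hroots n. [:- a, 1:])) z" if "z \<in> hroots n" for z
    using that finite_hroots[of n] by (simp add: poly_prod)
qed (simp_all add: card_hroots degree_hpoly)

section \<open>Exactness of Gauss-Hermite quadrature\<close>

text \<open>For a root \<open>a\<close> this is \<open>hpoly n / (X - a)\<close>: the Lagrange basis polynomial of \<open>a\<close>, not yet
  normalised by its value at \<open>a\<close>.\<close>

definition hcofactor :: "nat \<Rightarrow> real \<Rightarrow> real poly" where
  "hcofactor n a = smult (2 ^ n) (\<Prod>b\<in>hroots n - {a}. [:- b, 1:])"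

lemma hpoly_eq_mult_cofactor:
  assumes "a \<in> hroots n"
  shows "hpoly n = [:- a, 1:] * hcofactor n a"
  using assms by (subst hpoly_eq_prod) (simp add: hcofactor_def prod.remove[OF finite_hroots assms])

lemma poly_hcofactor:
  assumes "a \<in> hroots n" "b \<in> hroots n"
  shows "poly (hcofactor n a) b = (if a = b then deriv (hermite n) a else 0)"
proof (cases "a = b")
  case True
  have "pderiv (hpoly n) = [:- a, 1:] * pderiv (hcofactor n a) + hcofactor n a"
    by (subst hpoly_eq_mult_cofactor[OF assms(1)], subst pderiv_mult) (simp add: pderiv_pCons)
  then have "poly (pderiv (hpoly n)) a = poly (hcofactor n a) a"
    by simp
  then show ?thesis
    using True by (simp add: hermite_eq_hpoly DERIV_imp_deriv[OF poly_DERIV])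
next
  case False
  then have "b \<in> hroots n - {a}" using assms by simp
  then show ?thesis
    using False finite_hroots[of n] by (auto simp: hcofactor_def poly_prod)
qed

lemma deriv_hermite_nonzero:
  assumes "a \<in> hroots n"
  shows "deriv (hermite n) a \<noteq> 0"
proof -
  have "poly (hcofactor n a) a \<noteq> 0"
    using finite_hroots[of n] by (auto simp: hcofactor_def poly_prod)
  then show ?thesis using poly_hcofactor[OF assms assms] by simp
qed

lemma hcofactor_degree_coeff:
  assumes "a \<in> hroots n"
  shows "degree (hcofactor n a) = n - 1" "coeff (hcofactor n a) (n - 1) = 2 ^ n"
proof -
  have deg: "degree (\<Prod>b\<in>hroots n - {a}. [:- b, 1:]) = n - 1"
    using assms finite_hroots[of n] by (subst degree_prod_sum_eq) (simp_all add: card_hroots)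
  then show "degree (hcofactor n a) = n - 1"
    by (simp add: hcofactor_def)
  have "lead_coeff (\<Prod>b\<in>hroots n - {a}. [:- b, 1:]) = 1"
    by (simp add: lead_coeff_prod)
  with deg show "coeff (hcofactor n a) (n - 1) = 2 ^ n"
    by (simp add: hcofactor_def)
qed

text \<open>The interpolatory weight, that is, the Gaussian integral of the Lagrange basis polynomial of
  \<open>a\<close>. The closed form is derived only after exactness is known.\<close>

definition hweight :: "nat \<Rightarrow> real \<Rightarrow> real" where
  "hweight n a = gauss (hcofactor n a) / deriv (hermite n) a"

lemma gauss_eq_quadrature_low_degree:
  assumes "degree p < n"
  shows "gauss p = (\<Sum>a\<in>hroots n. hweight n a * poly p a)"
proof -
  let ?q = "\<Sum>a\<in>hroots n. smult (poly p a / deriv (hermite n) a) (hcofactor n a)"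
  have "p = ?q"
  proof (rule poly_eqI_degree[where A = "hroots n"])
    show "poly p x = poly ?q x" if "x \<in> hroots n" for x
    proof -
      have "poly ?q x = (\<Sum>a\<in>hroots n. if a = x then poly p x else 0)"
        using that by (auto simp: poly_sum poly_hcofactor deriv_hermite_nonzero intro!: sum.cong)
      then show ?thesis using that finite_hroots[of n] by simp
    qed
    have "degree ?q \<le> n - 1"
      using finite_hroots[of n] by (intro degree_sum_le) (auto simp: hcofactor_degree_coeff intro: order.trans[OF degree_smult_le])
    then show "degree ?q < card (hroots n)"
      using assms by (simp add: card_hroots)
  qed (use assms in \<open>simp add: card_hroots\<close>)
  then have "gauss p = gauss ?q" by (rule arg_cong)
  then show ?thesis
    by (simp add: gauss_sum gauss_smult hweight_def mult.commute)
qed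

text \<open>Division by \<open>hpoly n\<close> leaves a quotient and a remainder of degree less than \<open>n\<close>. The
  quotient term has integral zero by orthogonality, and it vanishes at the nodes.\<close>

lemma gauss_eq_quadrature:
  assumes "degree p < 2 * n"
  shows "gauss p = (\<Sum>a\<in>hroots n. hweight n a * poly p a)"
proof -
  let ?q = "p div hpoly n" and ?r = "p mod hpoly n"
  have n: "n > 0" using assms by simp
  have r: "degree ?r < n"
    using degree_mod_less[OF hpoly_nonzero[of n], of p] n by (auto simp: degree_hpoly)
  have "hpoly n * ?q = p - ?r"
    by (rule minus_mod_eq_mult_div[symmetric])
  then have "degree (hpoly n * ?q) < 2 * n"
    using degree_diff_less[of p "2 * n" ?r] assms r by simp
  then have q: "degree ?q < n"
    using n by (cases "?q = 0") (simp_all add: degree_mult_eq hpoly_nonzero degree_hpoly)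
  have "gauss p = gauss (hpoly n * ?q + ?r)" by simp
  also have "\<dots> = gauss (hpoly n * ?q) + gauss ?r"
    by (rule gauss_add)
  also have "gauss (hpoly n * ?q) = 0"
    using q by (simp add: gauss_hpoly coeff_eq_0)
  also have "0 + gauss ?r = (\<Sum>a\<in>hroots n. hweight n a * poly ?r a)"
    using gauss_eq_quadrature_low_degree[OF r] by simp
  also have "\<dots> = (\<Sum>a\<in>hroots n. hweight n a * poly p a)"
  proof (rule sum.cong)
    fix a assume a: "a \<in> hroots n"
    have "poly p a = poly (hpoly n * ?q + ?r) a" by simp
    also have "\<dots> = poly ?r a"
      unfolding poly_add poly_mult using a by simp
    finally show "hweight n a * poly ?r a = hweight n a * poly p a" by simp
  qed simp
  finally show ?thesis .
qed

lemma pderiv_hpoly_Suc: "pderiv (hpoly (Suc n)) = smult (2 * real (Suc n)) (hpoly n)"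
proof (induction n)
  case 0
  show ?case by (simp add: pderiv_pCons pderiv_1)
next
  case (Suc n)
  have "pderiv (hpoly (Suc (Suc n))) = smult 2 (hpoly (Suc n)) 
      + ([:0, 2:] * pderiv (hpoly (Suc n)) - pderiv (pderiv (hpoly (Suc n))))"
    by (subst hpoly.simps(2), subst pderiv_diff, subst pderiv_mult) (simp add: pderiv_pCons)
  also have "[:0, 2:] * pderiv (hpoly (Suc n)) - pderiv (pderiv (hpoly (Suc n))) =
     smult (2 * real (Suc n)) (hpoly (Suc n))"
    unfolding Suc by (simp only: pderiv_smult hpoly.simps(2)) (simp add: smult_diff_right)
  finally show ?case
    by (simp only: smult_add_left[symmetric]) (simp add: algebra_simps)
qed

text \<open>Both sides of the quadrature formula are evaluated on \<open>hpoly (n - 1) * hcofactor n a\<close>, of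
  degree \<open>2 n - 2\<close>. The integral only sees the leading coefficient \<open>2 ^ n\<close> of the cofactor, and
  the sum reduces to the node \<open>a\<close>; there \<open>hpoly (n - 1)\<close> is replaced by \<open>1 / (2 n)\<close> times the derivative of \<open>hpoly n\<close>.\<close>

lemma hweight_eq:
  assumes "a \<in> hroots n"
  shows "hweight n a = 2 ^ (n + 1) * fact n * sqrt pi / (deriv (hermite n) a)\<^sup>2"
proof -
  obtain m where n: "n = Suc m"
    using assms by (cases n) auto
  let ?p = "hpoly m * hcofactor n a"
  have "gauss ?p = fact m * 2 ^ n * sqrt pi"
    using hcofactor_degree_coeff[OF assms] n by (subst gauss_hpoly) auto
  moreover have "gauss ?p = (\<Sum>b\<in>hroots n. hweight n b * poly ?p b)"
    using degree_mult_le[of "hpoly m" "hcofactor n a"] hcofactor_degree_coeff[OF assms] n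
    by (intro gauss_eq_quadrature) (simp add: degree_hpoly)
  moreover have "\<dots> = (\<Sum>b\<in>hroots n. if b = a then hweight n a * (poly (hpoly m) a * deriv (hermite n) a) else 0)"
    using assms by (intro sum.cong) (auto simp: poly_hcofactor)
  moreover have "\<dots> = hweight n a * (poly (hpoly m) a * deriv (hermite n) a)"
    using assms finite_hroots[of n] by simp
  moreover have "deriv (hermite n) a = 2 * real n * poly (hpoly m) a"
    by (simp only: n hermite_eq_hpoly DERIV_imp_deriv[OF poly_DERIV] pderiv_hpoly_Suc poly_smult)
  ultimately have "hweight n a * (deriv (hermite n) a)\<^sup>2 = 2 * real n * (fact m * 2 ^ n * sqrt pi)"
    by (simp add: power2_eq_square mult_ac)
  then show ?thesis
    using deriv_hermite_nonzero[OF assms] n by (simp add: field_simps)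
qed

lemma gh_sum_eq:
  "(\<Sum>i = 1..n. gh_weight n i * g (gh_node n i)) = (\<Sum>a\<in>hroots n. hweight n a * g a)"
proof -
  define xs where "xs = sorted_list_of_set (hroots n)"
  have xs: "distinct xs" "set xs = hroots n" "length xs = n"
    using finite_hroots[of n] by (auto simp: xs_def card_hroots)
  have node: "gh_node n (Suc i) = xs ! i" for i
    by (simp add: gh_node_def hermite_eq_hpoly xs_def)
  have "(\<Sum>i = 1..n. gh_weight n i * g (gh_node n i)) = (\<Sum>i<n. gh_weight n (Suc i) * g (xs ! i))"
    by (simp add: sum.atLeast1_atMost_eq node)
  also have "\<dots> = (\<Sum>i<n. hweight n (xs ! i) * g (xs ! i))"
  proof (rule sum.cong)
    fix i assume "i \<in> {..<n}"
    then have "xs ! i \<in> hroots n"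
      using xs nth_mem[of i xs] by auto
    then show "gh_weight n (Suc i) * g (xs ! i) = hweight n (xs ! i) * g (xs ! i)"
      by (simp only: gh_weight_def node hweight_eq)
  qed simp
  also have "\<dots> = (\<Sum>a\<in>hroots n. hweight n a * g a)"
    using xs by (intro sum.reindex_bij_betw bij_betw_nth) auto
  finally show ?thesis .
qed

section \<open>Error of the conditional expectation\<close>

text \<open>The constant is not the sharp one that Hermite interpolation at the nodes would
  give, but it depends on \<open>n\<close> only, which suffices when \<open>K\<close> carries the power of the step size.\<close>

lemma quadrature_error:
  fixes g :: "real \<Rightarrow> real"
  assumes [measurable]: "g \<in> borel_measurable borel"
    and p: "degree p < 2 * n"
    and K: "\<And>s. \<bar>g s - poly p s\<bar> \<le> K * s ^ (2 * n)"
  shows "\<bar>(\<integral>s. g s * exp (- (s\<^sup>2)) \<partial>lborel) - (\<Sum>i = 1..n. gh_weight n i * g (gh_node n i))\<bar>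
    \<le> K * (gauss (monom 1 (2 * n)) + (\<Sum>a\<in>hroots n. \<bar>hweight n a\<bar> * a ^ (2 * n)))"
proof -
  define r where "r = (\<lambda>s. g s - poly p s)"
  have [measurable]: "r \<in> borel_measurable borel"
    unfolding r_def by measurable (intro borel_measurable_continuous_onI continuous_intros)
  have dom: "integrable lborel (\<lambda>s. K * (poly (monom 1 (2 * n)) s * exp (- (s\<^sup>2))))"
    by (intro integrable_mult_right integrable_poly_gauss)
  have bound: "\<bar>r s * exp (- (s\<^sup>2))\<bar> \<le> K * (poly (monom 1 (2 * n)) s * exp (- (s\<^sup>2)))" for s
    using K[of s] by (simp add: r_def abs_mult poly_monom mult.assoc[symmetric])
  have int: "integrable lborel (\<lambda>s. r s * exp (- (s\<^sup>2)))"
    using bound by (intro Bochner_Integration.integrable_bound[OF dom]) (auto intro: order.trans[OF _ abs_ge_self])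
  have "\<bar>\<integral>s. r s * exp (- (s\<^sup>2)) \<partial>lborel\<bar> \<le> (\<integral>s. K * (poly (monom 1 (2 * n)) s * exp (- (s\<^sup>2))) \<partial>lborel)"
    using Bochner_Integration.integral_norm_bound_integral[OF int dom] bound by simp
  then have 1: "\<bar>\<integral>s. r s * exp (- (s\<^sup>2)) \<partial>lborel\<bar> \<le> K * gauss (monom 1 (2 * n))"
    by (simp add: gauss_def)
  have "(\<integral>s. g s * exp (- (s\<^sup>2)) \<partial>lborel)
      = (\<integral>s. r s * exp (- (s\<^sup>2)) + poly p s * exp (- (s\<^sup>2)) \<partial>lborel)"
    by (simp add: r_def algebra_simps)
  also have "\<dots> = (\<integral>s. r s * exp (- (s\<^sup>2)) \<partial>lborel) + gauss p"
    unfolding gauss_def by (rule Bochner_Integration.integral_add[OF int integrable_poly_gauss])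
  finally have 2: "(\<integral>s. g s * exp (- (s\<^sup>2)) \<partial>lborel) = (\<integral>s. r s * exp (- (s\<^sup>2)) \<partial>lborel) + gauss p" .
  have 3: "(\<Sum>i = 1..n. gh_weight n i * g (gh_node n i)) = (\<Sum>a\<in>hroots n. hweight n a * r a) + gauss p"
    unfolding gh_sum_eq gauss_eq_quadrature[OF p] by (simp add: r_def algebra_simps flip: sum.distrib)
  have "\<bar>\<Sum>a\<in>hroots n. hweight n a * r a\<bar> \<le> (\<Sum>a\<in>hroots n. K * (\<bar>hweight n a\<bar> * a ^ (2 * n)))"
  proof (rule order.trans[OF sum_abs sum_mono])
    fix a
    show "\<bar>hweight n a * r a\<bar> \<le> K * (\<bar>hweight n a\<bar> * a ^ (2 * n))"
      using mult_left_mono[OF K[of a], of "\<bar>hweight n a\<bar>"] by (simp add: r_def abs_mult mult_ac)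
  qed
  then have 4: "\<bar>\<Sum>a\<in>hroots n. hweight n a * r a\<bar> \<le> K * (\<Sum>a\<in>hroots n. \<bar>hweight n a\<bar> * a ^ (2 * n))"
    by (simp add: sum_distrib_left)
  show ?thesis
    unfolding 2 3 distrib_left using 1 4 by linarith
qed

text \<open>The expansion is taken in the variable \<open>c * s\<close>, which turns the step size \<open>c\<close> into a factor
  \<open>c ^ n\<close> of the remainder. For even \<open>n\<close> the bound is a multiple of a monomial in \<open>s\<close>,
  so the functional \<open>gauss\<close> applies to it.\<close>

lemma taylor_poly:
  fixes g :: "real \<Rightarrow> real"
  assumes diff: "\<And>i x. i < n \<Longrightarrow> (deriv ^^ i) g field_differentiable at x"
    and B: "\<And>x. \<bar>(deriv ^^ n) g x\<bar> \<le> B" and n: "n > 0" "even n"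
  obtains p where "degree p < n"
    "\<And>s. \<bar>g (x + c * s) - poly p s\<bar> \<le> B * c ^ n / fact n * s ^ n"
proof -
  define p where "p = (\<Sum>m<n. monom ((deriv ^^ m) g x / fact m * c ^ m) m)"
  have "degree p \<le> n - 1"
    unfolding p_def by (intro degree_sum_le) (auto intro: order.trans[OF degree_monom_le])
  then have "degree p < n" using n by simp
  moreover have "\<bar>g (x + c * s) - poly p s\<bar> \<le> B * c ^ n / fact n * s ^ n" for s
  proof -
    have "\<forall>m t. m < n \<and> \<bar>t\<bar> \<le> \<bar>c * s\<bar> \<longrightarrow>
        ((\<lambda>v. (deriv ^^ m) g (x + v)) has_real_derivative (deriv ^^ Suc m) g (x + t)) (at t)"
    proof (intro allI impI)
      fix m t assume "m < n \<and> \<bar>t\<bar> \<le> \<bar>c * s\<bar>"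
      then have "((deriv ^^ m) g has_real_derivative (deriv ^^ Suc m) g (x + t)) (at (x + t))"
        using diff[of m "x + t"] by (simp add: field_differentiable_derivI)
      then show "((\<lambda>v. (deriv ^^ m) g (x + v)) has_real_derivative (deriv ^^ Suc m) g (x + t)) (at t)"
        by (simp add: DERIV_shift add.commute)
    qed
    from Maclaurin_bi_le[OF _ this, of "\<lambda>v. g (x + v)"]
    obtain t where t: "g (x + c * s) = (\<Sum>m<n. (deriv ^^ m) g x / fact m * (c * s) ^ m)
        + (deriv ^^ n) g (x + t) / fact n * (c * s) ^ n"
      by auto
    have "poly p s = (\<Sum>m<n. (deriv ^^ m) g x / fact m * (c * s) ^ m)"
      by (simp add: p_def poly_sum poly_monom power_mult_distrib mult.assoc)
    with t have "\<bar>g (x + c * s) - poly p s\<bar> = \<bar>(deriv ^^ n) g (x + t)\<bar> * ((c * s) ^ n / fact n)"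
      using zero_le_even_power[OF n(2), of "c * s"] by (simp add: abs_mult)
    also have "\<dots> \<le> B * ((c * s) ^ n / fact n)"
      using zero_le_even_power[OF n(2), of "c * s"] by (intro mult_right_mono B) simp
    finally show ?thesis by (simp add: power_mult_distrib mult_ac)
  qed
  ultimately show thesis using that by blast
qed

lemma (in brownian_motion) start_expectation_eq:
  assumes st: "0 \<le> s" "s < t" "t \<le> T" and [measurable]: "u t \<in> borel_measurable borel"
  shows "start_expectation M W u s t x
    = 1 / sqrt pi * (\<integral>v. u t (x + sqrt (2 * (t - s)) * v) * exp (- (v\<^sup>2)) \<partial>lborel)"
proof -
  let ?\<delta> = "t - s"
  have density: "sqrt (2 * \<delta>) * (normal_density 0 (sqrt \<delta>) (sqrt (2 * \<delta>) * v) * c)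
      = 1 / sqrt pi * (c * exp (- (v\<^sup>2)))" if "\<delta> > 0" for \<delta> v c
    using that by (simp add: normal_density_def power_mult_distrib real_sqrt_mult)
  have "start_expectation M W u s t x = (\<integral>\<omega>. u t (x + (W t \<omega> - W s \<omega>)) \<partial>M)"
    by (simp add: start_expectation_def algebra_simps)
  also have "\<dots> = (\<integral>v. normal_density 0 (sqrt ?\<delta>) v * u t (x + v) \<partial>lborel)"
    using st by (intro distributed_integral[OF W_increment, symmetric]) auto
  also have "\<dots> = sqrt (2 * ?\<delta>) * (\<integral>v. normal_density 0 (sqrt ?\<delta>) (sqrt (2 * ?\<delta>) * v) * u t (x + sqrt (2 * ?\<delta>) * v) \<partial>lborel)"
    using st by (subst lborel_integral_real_affine[where c = "sqrt (2 * ?\<delta>)" and t = 0]) auto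
  also have "\<dots> = (\<integral>v. 1 / sqrt pi * (u t (x + sqrt (2 * ?\<delta>) * v) * exp (- (v\<^sup>2))) \<partial>lborel)"
    unfolding integral_mult_right_zero[symmetric] using st by (subst density) simp_all
  finally show ?thesis by simp
qed

theorem mainTheorem1:
  fixes M :: "'a measure" and F :: "real \<Rightarrow> 'a measure" and T :: real
    and W y z :: "real \<Rightarrow> 'a \<Rightarrow> real"
    and f :: "real \<Rightarrow> real \<Rightarrow> real \<Rightarrow> real" and \<phi> :: "real \<Rightarrow> real"
    and u :: "real \<Rightarrow> real \<Rightarrow> real" and k L :: nat
  assumes "T > 0"
    and "brownian_motion M F T W"
    and "k \<ge> 1"
    and "Cb k ({0..T} \<times> UNIV \<times> UNIV) (\<lambda>(t, a, b). f t a b)"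
    and "Cb k UNIV \<phi>"
    and "bsde_solution M F T W f \<phi> y z"
    and "pde_solution T f \<phi> u"
    and "represents M T W u y z"
    and "L \<ge> 1"
    and "bounded_x_derivative T (2 * L) u"
  shows "\<exists>C. \<forall>N n j. \<forall>h x. h = T / real N \<longrightarrow> j \<ge> 1 \<longrightarrow> n + j \<le> N \<longrightarrow>
    \<bar>start_expectation M W u (real n * h) (real (n + j) * h) x
      - gh_expectation L u (real j * h) (real (n + j) * h) x\<bar> \<le> C * (real j * h) ^ L"
proof -
  interpret brownian_motion M F T W by fact
  obtain B where diff: "\<And>t i x. t \<in> {0..T} \<Longrightarrow> i < 2 * L \<Longrightarrow> (deriv ^^ i) (u t) field_differentiable at x"
    and B: "\<And>t x. t \<in> {0..T} \<Longrightarrow> \<bar>(deriv ^^ (2 * L)) (u t) x\<bar> \<le> B"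
    using assms(10) unfolding bounded_x_derivative_def by blast
  define Q where "Q = gauss (monom 1 (2 * L)) + (\<Sum>a\<in>hroots L. \<bar>hweight L a\<bar> * a ^ (2 * L))"
  define C where "C = 1 / sqrt pi * (B * 2 ^ L / fact (2 * L) * Q)"
  have "\<bar>start_expectation M W u (real n * h) (real (n + j) * h) x
      - gh_expectation L u (real j * h) (real (n + j) * h) x\<bar> \<le> C * (real j * h) ^ L"
    if h: "h = T / real N" and j: "j \<ge> 1" and N: "n + j \<le> N" for N n j h x
  proof -
    define s t \<delta> where "s = real n * h" and "t = real (n + j) * h" and "\<delta> = real j * h"
    \<comment> \<open>The condition \<open>1 \<le> j\<close>, \<open>n + j \<le> N\<close> excludes \<open>N = 0\<close>, where \<open>h = T / 0 = 0\<close>.\<close>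
    have "h > 0" using h j N \<open>T > 0\<close> by simp
    have "real (n + j) * h \<le> real N * h"
      using N \<open>h > 0\<close> by (intro mult_right_mono) auto
    also have "\<dots> = T" using h j N by simp
    finally have st: "0 \<le> s" "s < t" "t \<le> T" and \<delta>: "\<delta> > 0" "t - s = \<delta>"
      using \<open>h > 0\<close> j by (auto simp: s_def t_def \<delta>_def algebra_simps)
    have t: "t \<in> {0..T}" using st by simp
    define g where "g v = u t (x + sqrt (2 * \<delta>) * v)" for v
    have "continuous_on UNIV (u t)"
      using diff[OF t, of 0] \<open>L \<ge> 1\<close>
      by (auto intro!: continuous_at_imp_continuous_on field_differentiable_imp_continuous_at)
    then have meas[measurable]: "u t \<in> borel_measurable borel"
      by (rule borel_measurable_continuous_onI)
    obtain p where p: "degree p < 2 * L"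
      "\<And>v. \<bar>g v - poly p v\<bar> \<le> B * sqrt (2 * \<delta>) ^ (2 * L) / fact (2 * L) * v ^ (2 * L)"
      unfolding g_def using taylor_poly[of "2 * L" "u t" B x "sqrt (2 * \<delta>)"] diff[OF t] B[OF t] \<open>L \<ge> 1\<close>
      by auto
    have "\<bar>(\<integral>v. g v * exp (- (v\<^sup>2)) \<partial>lborel) - (\<Sum>i = 1..L. gh_weight L i * g (gh_node L i))\<bar>
        \<le> B * sqrt (2 * \<delta>) ^ (2 * L) / fact (2 * L) * Q"
      unfolding Q_def by (rule quadrature_error[OF _ p]) (unfold g_def, measurable)
    also have "\<dots> = B * 2 ^ L / fact (2 * L) * Q * \<delta> ^ L"
      using \<delta> by (simp add: power_mult power_mult_distrib)
    finally have "1 / sqrt pi * \<bar>(\<integral>v. g v * exp (- (v\<^sup>2)) \<partial>lborel) - (\<Sum>i = 1..L. gh_weight L i * g (gh_node L i))\<bar>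
        \<le> 1 / sqrt pi * (B * 2 ^ L / fact (2 * L) * Q * \<delta> ^ L)"
      by (intro mult_left_mono) auto
    also have "\<dots> = C * \<delta> ^ L"
      by (simp add: C_def)
    also have "1 / sqrt pi * \<bar>(\<integral>v. g v * exp (- (v\<^sup>2)) \<partial>lborel) - (\<Sum>i = 1..L. gh_weight L i * g (gh_node L i))\<bar>
        = \<bar>start_expectation M W u s t x - gh_expectation L u \<delta> t x\<bar>"
      by (simp only: start_expectation_eq[where u = u, OF st meas] \<delta> gh_expectation_def g_def
          right_diff_distrib[symmetric] abs_mult) simp
    finally show ?thesis
      by (simp only: s_def t_def \<delta>_def)
  qed
  then show ?thesis by blast
qed

end
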